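(* Let $k\ge 1$ and let $G$ be a $k$-tree of order $n$. If $G$ is chromatic dominated, then its diameter satisfies $\mathrm{diam}(G)\le \min\{2k+1,\;2(n-k)+1\}$.
   Context: A set $S$ of vertices of a graph $G$ is dominated by a vertex $v$ if every vertex of $S$ is adjacent to $v$. A dominated coloring of $G$ is a proper vertex coloring in which each (nonempty) color class is dominated by some vertex of $G$; $\chi_{dom}(G)$ is the minimum number of colors in a dominated coloring of $G$. $G$ is chromatic dominated if $\chi(G)=\chi_{dom}(G)$, where $\chi(G)$ is the chromatic number (a graph with no dominated coloring, such as a single vertex, is not chromatic dominated). A $k$-tree is a graph that can be reduced to the complete graph on $k$ vertices by a sequence of removals of a degree-$k$ vertex whose neighbors are pairwise adjacent. The order of $G$ is its number of vertices. *)

theory Defs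
  imports "Graph_Theory.Graph_Theory" "HOL-Library.Extended_Nat"
begin

text \<open>
  Finite simple graphs are the \<^locale>\<open>graph\<close>s of the library, i.e. finite symmetric digraphs
  without loops and parallel arcs. Beware that the library abbreviation \<open>dominates G u v\<close>,
  written \<open>u \<rightarrow>\<^bsub>G\<^esub> v\<close>, is adjacency of two vertices; domination of a set is
  \<open>dominated_by\<close> below.
\<close>

definition dominated_by :: "('a, 'b) pre_digraph \<Rightarrow> 'a set \<Rightarrow> 'a \<Rightarrow> bool" where
  "dominated_by G S v \<longleftrightarrow> (\<forall>u\<in>S. u \<rightarrow>\<^bsub>G\<^esub> v)"

text \<open>Only the values of a coloring on \<open>verts G\<close> matter; the colors used are \<open>c ` verts G\<close>.\<close>

definition proper_coloring :: "('a, 'b) pre_digraph \<Rightarrow> ('a \<Rightarrow> nat) \<Rightarrow> bool" where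
  "proper_coloring G c \<longleftrightarrow> (\<forall>u\<in>verts G. \<forall>v\<in>verts G. u \<rightarrow>\<^bsub>G\<^esub> v \<longrightarrow> c u \<noteq> c v)"

definition color_class :: "('a, 'b) pre_digraph \<Rightarrow> ('a \<Rightarrow> nat) \<Rightarrow> nat \<Rightarrow> 'a set" where
  "color_class G c i = {u \<in> verts G. c u = i}"

definition dominated_coloring :: "('a, 'b) pre_digraph \<Rightarrow> ('a \<Rightarrow> nat) \<Rightarrow> bool" where
  "dominated_coloring G c \<longleftrightarrow>
     proper_coloring G c \<and>
     (\<forall>i \<in> c ` verts G. \<exists>v\<in>verts G. dominated_by G (color_class G c i) v)"

text \<open>
  In \<^typ>\<open>enat\<close> the infimum of a nonempty set is attained, so the following are minima, with
  value \<open>\<infinity>\<close> if there is no coloring of the required kind. As the chromatic number of a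
  finite simple graph is finite, a graph without dominated coloring is not chromatic dominated.
\<close>

definition chromatic_number :: "('a, 'b) pre_digraph \<Rightarrow> enat" where
  "chromatic_number G = (INF c \<in> {c. proper_coloring G c}. enat (card (c ` verts G)))"

definition dominated_chromatic_number :: "('a, 'b) pre_digraph \<Rightarrow> enat" where
  "dominated_chromatic_number G =
     (INF c \<in> {c. dominated_coloring G c}. enat (card (c ` verts G)))"

definition chromatic_dominated :: "('a, 'b) pre_digraph \<Rightarrow> bool" where
  "chromatic_dominated G \<longleftrightarrow> chromatic_number G = dominated_chromatic_number G"

lemma chromatic_dominated_imp_dominated_coloring:
  assumes "graph G" and "chromatic_dominated G"
  shows "\<exists>c. dominated_coloring G c"
proof (rule ccontr)
  assume "\<nexists>c. dominated_coloring G c"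
  then have top: "chromatic_number G = \<infinity>"
    using assms(2)
    by (simp add: chromatic_dominated_def dominated_chromatic_number_def top_enat_def)
  interpret graph G by fact
  obtain c :: "'a \<Rightarrow> nat" where inj: "inj_on c (verts G)"
    using finite_imp_inj_to_nat_seg[OF finite_verts] by blast
  have "proper_coloring G c"
    unfolding proper_coloring_def using inj adj_not_same by (metis inj_onD)
  then have "chromatic_number G \<le> enat (card (c ` verts G))"
    unfolding chromatic_number_def by (intro INF_lower) simp
  with top show False by simp
qed

text \<open>
  The neighbors of \<open>v\<close> are the \<open>u\<close> with \<open>v \<rightarrow>\<^bsub>G\<^esub> u\<close>; each edge at \<open>v\<close> contributes exactly
  one outgoing arc, so the degree of \<open>v\<close> is its out-degree.
\<close>

inductive k_tree :: "nat \<Rightarrow> ('a, 'b) pre_digraph \<Rightarrow> bool" for k :: nat where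
  complete: "K\<^bsub>k\<^esub> G \<Longrightarrow> k_tree k G"
| remove: "\<lbrakk>graph G; v \<in> verts G; out_degree G v = k;
      \<And>u w. \<lbrakk>v \<rightarrow>\<^bsub>G\<^esub> u; v \<rightarrow>\<^bsub>G\<^esub> w; u \<noteq> w\<rbrakk> \<Longrightarrow> u \<rightarrow>\<^bsub>G\<^esub> w;
      k_tree k (pre_digraph.del_vert G v)\<rbrakk> \<Longrightarrow> k_tree k G"

lemma k_tree_graph: "k_tree k G \<Longrightarrow> graph G"
  by (erule k_tree.cases) (auto simp: complete_digraph_def)

text \<open>
  The distance is the library's shortest-path cost with unit arc weights; it is \<open>\<infinity>\<close> between
  vertices in different components.
\<close>

definition graph_dist :: "('a, 'b) pre_digraph \<Rightarrow> 'a \<Rightarrow> 'a \<Rightarrow> ereal" where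
  "graph_dist G u v = wf_digraph.\<mu> G (\<lambda>_. 1) u v"

definition diam :: "('a, 'b) pre_digraph \<Rightarrow> ereal" where
  "diam G = (SUP (u, v) \<in> verts G \<times> verts G. graph_dist G u v)"

end

theory Submission
  imports Defs
begin

text \<open>
  Both bounds hold for the distance \<open>d\<close> of any two vertices. That \<open>d\<close> is finite, and in fact at
  most \<open>n - k + 1\<close>, follows by building up the \<open>k\<close>-tree: any two vertices of the initial
  complete graph are at distance at most \<open>1\<close>, and since \<open>k \<ge> 1\<close> each new vertex has a neighbor
  among the earlier ones, so it raises the largest distance by at most \<open>1\<close>
  (\<open>k_tree_short_walk\<close>). As \<open>n \<ge> k\<close>, this is at most \<open>2 (n - k) + 1\<close>.

  For the bound \<open>2 k + 1\<close>, the same construction colors \<open>G\<close> greedily with \<open>k + 1\<close> colors,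
  because a new vertex sees at most \<open>k\<close> of them (\<open>k_tree_coloring\<close>). As \<open>G\<close> is chromatic
  dominated, some dominated coloring also gets by with \<open>k + 1\<close> colors. Two vertices of one color
  class have a common neighbor, so on a shortest walk they are at most two steps apart; being
  non-adjacent, they are not exactly one step apart. Hence a color class contains at most two of
  the \<open>d + 1\<close> vertices of a shortest walk (\<open>dominated_coloring_shortest_walk\<close>), and
  \<open>d + 1 \<le> 2 (k + 1)\<close>.

  A walk of length \<open>m\<close> from \<open>u\<close> to \<open>v\<close> is expressed by \<open>(u, v) \<in> arcs_ends G ^^ m\<close>.
\<close>

section \<open>Walks and distance\<close>

lemma (in wf_digraph) awalk_of_relpow:
  assumes "(u, v) \<in> arcs_ends G ^^ m" and "v \<in> verts G"
  shows "\<exists>p. awalk u p v \<and> length p = m"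
  using assms(1)
proof (induction m arbitrary: u)
  case 0
  then show ?case
    using assms(2) by (auto simp: awalk_Nil_iff)
next
  case (Suc m)
  then obtain w where "(u, w) \<in> arcs_ends G" "(w, v) \<in> arcs_ends G ^^ m"
    by (meson relpow_Suc_E2)
  moreover obtain e where "e \<in> arcs G" "arc_to_ends G e = (u, w)"
    using \<open>(u, w) \<in> arcs_ends G\<close> by (auto simp: arcs_ends_def)
  ultimately show ?case
    using Suc.IH awalk_ConsI by (metis length_Cons)
qed

lemma graph_dist_le_of_relpow:
  assumes "wf_digraph G" and "(u, v) \<in> arcs_ends G ^^ m" and "v \<in> verts G"
  shows "graph_dist G u v \<le> ereal (real m)"
proof -
  interpret wf_digraph G by fact
  obtain p where p: "awalk u p v" "length p = m"
    using awalk_of_relpow assms(2,3) by blast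
  have "awalk_cost (\<lambda>_. 1) p = real m"
    using p(2) by (simp add: awalk_cost_def sum_list_triv)
  then show ?thesis
    using min_cost_le_walk_cost[OF p(1), of "\<lambda>_. 1"] by (simp add: graph_dist_def)
qed

section \<open>Walks and colorings in k-trees\<close>

lemma dominates_del_vert_iff:
  "x \<rightarrow>\<^bsub>pre_digraph.del_vert G v\<^esub> y \<longleftrightarrow> x \<rightarrow>\<^bsub>G\<^esub> y \<and> x \<noteq> v \<and> y \<noteq> v"
  by (auto simp: arcs_ends_conv pre_digraph.verts_del_vert pre_digraph.arcs_del_vert
      pre_digraph.tail_del_vert pre_digraph.head_del_vert)

lemma out_neighbors_eq: "{u. v \<rightarrow>\<^bsub>G\<^esub> u} = head G ` out_arcs G v"
  by (auto simp: arcs_ends_conv out_arcs_def)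

lemma k_tree_order_ge:
  assumes "k_tree k G"
  shows "k \<le> card (verts G)"
  using assms
proof induction
  case (complete G)
  then show ?case by (simp add: complete_digraph_def)
next
  case (remove G v)
  interpret graph G by fact
  have "card (verts G - {v}) \<le> card (verts G)"
    by (simp add: card_mono)
  with remove.IH show ?case
    by (simp add: pre_digraph.verts_del_vert)
qed

text \<open>
  Every vertex that is added to a \<open>k\<close>-tree is adjacent to an earlier vertex, so that walks to
  the latter extend to the former by one step.
\<close>

lemma k_tree_short_walk:
  assumes "k_tree k G" and "k \<ge> 1" and "x \<in> verts G" and "y \<in> verts G"
  shows "\<exists>m. m + k \<le> card (verts G) + 1 \<and> (x, y) \<in> arcs_ends G ^^ m"
  using assms(1,3,4)
proof (induction arbitrary: x y)
  case (complete G)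
  show ?case
  proof (cases "x = y")
    case True
    then show ?thesis
      using complete by (intro exI[of _ 0]) (simp add: complete_digraph_def)
  next
    case False
    then show ?thesis
      using complete by (intro exI[of _ 1]) (auto simp: complete_digraph_def)
  qed
next
  case (remove G v)
  interpret graph G by fact
  let ?H = "pre_digraph.del_vert G v"
  have "{u. v \<rightarrow>\<^bsub>G\<^esub> u} \<noteq> {}"
    using remove.hyps(3) \<open>k \<ge> 1\<close> by (auto simp: out_neighbors_eq out_degree_def)
  then obtain u where vu: "v \<rightarrow>\<^bsub>G\<^esub> u" by blast
  then have uv: "u \<rightarrow>\<^bsub>G\<^esub> v"
    using sym_arcs by (auto simp: symmetric_def dest: symD)
  have uH: "u \<in> verts ?H"
    using vu adj_not_same adj_in_verts by (auto simp: verts_del_vert)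
  have card: "card (verts G) = card (verts ?H) + 1"
    using remove.hyps(2) card_Suc_Diff1[of "verts G" v] by (simp add: verts_del_vert)
  have order: "k \<le> card (verts ?H)"
    using remove.hyps(5) by (rule k_tree_order_ge)
  have walk: "\<exists>m. m + k \<le> card (verts ?H) + 1 \<and> (a, b) \<in> arcs_ends G ^^ m"
    if "a \<in> verts ?H" "b \<in> verts ?H" for a b
  proof -
    have "arcs_ends ?H \<subseteq> arcs_ends G"
      by (auto simp: dominates_del_vert_iff)
    then have "arcs_ends ?H ^^ m \<subseteq> arcs_ends G ^^ m" for m
      by (induction m) auto
    then show ?thesis
      using remove.IH[OF that] by blast
  qed
  consider "x = v" "y = v" | "x = v" "y \<in> verts ?H" | "x \<in> verts ?H" "y = v"
    | "x \<in> verts ?H" "y \<in> verts ?H"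
    using remove.prems by (auto simp: verts_del_vert)
  then show ?case
  proof cases
    case 1
    then show ?thesis
      using card order by (intro exI[of _ 0]) simp
  next
    case 2
    obtain m where m: "m + k \<le> card (verts ?H) + 1" "(u, y) \<in> arcs_ends G ^^ m"
      using walk[OF uH 2(2)] by blast
    have "(x, y) \<in> arcs_ends G ^^ Suc m"
      using relpow_Suc_I2[OF vu m(2)] 2(1) by simp
    then show ?thesis
      using m(1) card by (intro exI[of _ "Suc m"]) simp
  next
    case 3
    obtain m where m: "m + k \<le> card (verts ?H) + 1" "(x, u) \<in> arcs_ends G ^^ m"
      using walk[OF 3(1) uH] by blast
    have "(x, y) \<in> arcs_ends G ^^ Suc m"
      using relpow_Suc_I[OF m(2) uv] 3(2) by simp
    then show ?thesis
      using m(1) card by (intro exI[of _ "Suc m"]) simp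
  next
    case 4
    obtain m where "m + k \<le> card (verts ?H) + 1" "(x, y) \<in> arcs_ends G ^^ m"
      using walk[OF 4] by blast
    then show ?thesis
      using card by (intro exI[of _ m]) simp
  qed
qed

lemma k_tree_coloring:
  assumes "k_tree k G"
  shows "\<exists>c. proper_coloring G c \<and> c ` verts G \<subseteq> {..k}"
  using assms
proof induction
  case (complete G)
  then interpret graph G by (simp add: complete_digraph_def)
  obtain c where c: "bij_betw c (verts G) {0..<card (verts G)}"
    using ex_bij_betw_finite_nat[OF finite_verts] by blast
  have "c u \<noteq> c v" if "u \<rightarrow>\<^bsub>G\<^esub> v" for u v
    using that c adj_not_same adj_in_verts by (metis bij_betw_imp_inj_on inj_onD)
  moreover have "c ` verts G \<subseteq> {..k}"
    using c complete by (auto simp: complete_digraph_def bij_betw_def)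
  ultimately show ?case
    unfolding proper_coloring_def by blast
next
  case (remove G v)
  interpret graph G by fact
  let ?N = "{u. v \<rightarrow>\<^bsub>G\<^esub> u}"
  obtain c where c: "proper_coloring (del_vert v) c" "c ` verts (del_vert v) \<subseteq> {..k}"
    using remove.IH by blast
  \<comment> \<open>At most \<open>k\<close> of the \<open>k + 1\<close> colors occur on the neighbors of \<open>v\<close>.\<close>
  have "finite (out_arcs G v)" by blast
  then have "card (c ` ?N) \<le> k" "finite (c ` ?N)"
    using remove.hyps(3) surj_card_le[of "out_arcs G v" "c ` ?N" "c \<circ> head G"]
    by (auto simp: out_neighbors_eq out_degree_def image_comp)
  then have "\<not> {..k} \<subseteq> c ` ?N"
    using card_mono[of "c ` ?N" "{..k}"] by auto
  then obtain i where i: "i \<le> k" "i \<notin> c ` ?N" by blast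
  have sym: "y \<rightarrow>\<^bsub>G\<^esub> x" if "x \<rightarrow>\<^bsub>G\<^esub> y" for x y
    using that sym_arcs by (auto simp: symmetric_def dest: symD)
  have "(c(v := i)) x \<noteq> (c(v := i)) y" if xy: "x \<rightarrow>\<^bsub>G\<^esub> y" for x y
  proof -
    consider "x = v" "y = v" | "x = v" "y \<noteq> v" | "x \<noteq> v" "y = v" | "x \<noteq> v" "y \<noteq> v"
      by blast
    then show ?thesis
    proof cases
      case 1
      then show ?thesis using xy adj_not_same by blast
    next
      case 2
      then show ?thesis using xy i(2) by auto
    next
      case 3
      then show ?thesis using sym[OF xy] i(2) by auto
    next
      case 4
      then show ?thesis
        using xy c(1) adj_in_verts[OF xy]
        by (simp add: proper_coloring_def dominates_del_vert_iff verts_del_vert)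
    qed
  qed
  moreover have "(c(v := i)) ` verts G \<subseteq> {..k}"
    using c(2) i(1) by (auto simp: verts_del_vert)
  ultimately show ?case
    unfolding proper_coloring_def by blast
qed

section \<open>Dominated colorings\<close>

lemma chromatic_dominated_obtain_coloring:
  assumes "chromatic_dominated G" and "proper_coloring G c"
  obtains c' where "dominated_coloring G c'" and "card (c' ` verts G) \<le> card (c ` verts G)"
proof -
  let ?D = "(\<lambda>c. enat (card (c ` verts G))) ` {c. dominated_coloring G c}"
  have "Inf ?D \<le> enat (card (c ` verts G))"
    using assms INF_lower[of c "{c. proper_coloring G c}" "\<lambda>c. enat (card (c ` verts G))"]
    by (simp add: chromatic_dominated_def chromatic_number_def dominated_chromatic_number_def)
  \<comment> \<open>A strict bound on the infimum produces a coloring, whether or not \<open>?D\<close> is empty.\<close>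
  then have "Inf ?D < enat (Suc (card (c ` verts G)))"
    by (rule order_le_less_trans) simp
  then obtain c' where "dominated_coloring G c'" "card (c' ` verts G) < Suc (card (c ` verts G))"
    unfolding Inf_less_iff by auto
  then show thesis
    using that by simp
qed

text \<open>
  A common neighbor of two vertices of the walk with indices \<open>i\<close> and \<open>j\<close> yields a detour of
  length two between them, so minimality forces \<open>j \<le> i + 2\<close>. Adjacent vertices have different
  colors, which leaves each color at most the indices \<open>i\<close> and \<open>i + 2\<close>, where \<open>i\<close> is its first
  one.
\<close>

lemma dominated_coloring_shortest_walk:
  assumes "graph G" and c: "dominated_coloring G c"
    and "u \<in> verts G" and walk: "(u, v) \<in> arcs_ends G ^^ m"
    and minimal: "\<And>l. (u, v) \<in> arcs_ends G ^^ l \<Longrightarrow> m \<le> l"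
  shows "m + 1 \<le> 2 * card (c ` verts G)"
proof -
  interpret graph G by fact
  obtain f where f: "f 0 = u" "f m = v" "\<And>i. i < m \<Longrightarrow> f i \<rightarrow>\<^bsub>G\<^esub> f (Suc i)"
    using walk unfolding relpow_fun_conv by blast
  have f_verts: "f i \<in> verts G" if "i \<le> m" for i
  proof (cases i)
    case 0
    then show ?thesis using f(1) assms(3) by simp
  next
    case (Suc l)
    then show ?thesis using f(3)[of l] that adj_in_verts by simp
  qed
  have sub: "(f i, f j) \<in> arcs_ends G ^^ (j - i)" if "i \<le> j" "j \<le> m" for i j
    unfolding relpow_fun_conv
    using that f(3) by (intro exI[of _ "\<lambda>l. f (i + l)"]) auto
  have close: "j = i + 2" if ij: "i < j" "j \<le> m" and col: "c (f i) = c (f j)" for i j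
  proof -
    have "f i \<in> verts G" "f j \<in> verts G"
      using ij f_verts by auto
    then obtain w where w: "f i \<rightarrow>\<^bsub>G\<^esub> w" "f j \<rightarrow>\<^bsub>G\<^esub> w"
      using c col unfolding dominated_coloring_def dominated_by_def color_class_def by blast
    then have "w \<rightarrow>\<^bsub>G\<^esub> f j"
      using sym_arcs by (auto simp: symmetric_def dest: symD)
    moreover have "(u, f i) \<in> arcs_ends G ^^ i" "(f j, v) \<in> arcs_ends G ^^ (m - j)"
      using sub[of 0 i] sub[of j m] f(1,2) ij by auto
    ultimately have "(u, v) \<in> arcs_ends G ^^ (Suc (Suc i) + (m - j))"
      using w(1) unfolding relpow_add by auto
    then have "j \<le> i + 2"
      using minimal ij by fastforce
    moreover have "j \<noteq> Suc i"
    proof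
      assume "j = Suc i"
      then have "f i \<rightarrow>\<^bsub>G\<^esub> f j" using f(3) ij by simp
      then show False
        using c col adj_in_verts unfolding dominated_coloring_def proper_coloring_def by blast
    qed
    ultimately show ?thesis using ij by simp
  qed
  define fiber where "fiber a = {i. i \<le> m \<and> c (f i) = a}" for a
  have fiber: "card (fiber a) \<le> 2" for a
  proof (cases "fiber a = {}")
    case False
    define i where "i = Min (fiber a)"
    have fin: "finite (fiber a)" by (simp add: fiber_def)
    then have i: "i \<in> fiber a" and least: "\<And>j. j \<in> fiber a \<Longrightarrow> i \<le> j"
      using False by (simp_all add: i_def)
    have "j \<in> {i, i + 2}" if "j \<in> fiber a" for j
    proof (cases "j = i")
      case False
      then have "i < j" using least[OF that] by simp
      then show ?thesis
        using close[of i j] that i by (simp add: fiber_def)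
    qed simp
    then have "fiber a \<subseteq> {i, i + 2}" by blast
    then have "card (fiber a) \<le> card {i, i + 2}"
      by (intro card_mono) auto
    then show ?thesis by simp
  qed simp
  have "{..m} \<subseteq> (\<Union>a\<in>c ` verts G. fiber a)"
    using f_verts by (auto simp: fiber_def)
  then have "card {..m} \<le> card (\<Union>a\<in>c ` verts G. fiber a)"
    by (intro card_mono) (auto simp: fiber_def)
  also have "\<dots> \<le> (\<Sum>a\<in>c ` verts G. card (fiber a))"
    by (intro card_UN_le) simp
  also have "\<dots> \<le> (\<Sum>a\<in>c ` verts G. 2)"
    by (intro sum_mono fiber)
  finally show ?thesis by simp
qed

section \<open>The diameter\<close>

theorem theorem2p8:
  fixes G :: "('a, 'b) pre_digraph" and k n :: nat
  assumes "k \<ge> 1"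
    and "k_tree k G"
    and "card (verts G) = n"
    and "chromatic_dominated G"
  shows "diam G \<le> ereal (min (2 * real k + 1) (2 * (real n - real k) + 1))"
proof -
  interpret graph G using assms(2) by (rule k_tree_graph)
  have order: "k \<le> n"
    using k_tree_order_ge assms(2,3) by blast
  obtain c where "proper_coloring G c" "c ` verts G \<subseteq> {..k}"
    using k_tree_coloring assms(2) by blast
  moreover from this have "card (c ` verts G) \<le> k + 1"
    using card_mono[of "{..k}"] by fastforce
  ultimately obtain c' where c': "dominated_coloring G c'" "card (c' ` verts G) \<le> k + 1"
    using chromatic_dominated_obtain_coloring assms(4) by (metis le_trans)
  have "graph_dist G u v \<le> ereal (min (2 * real k + 1) (2 * (real n - real k) + 1))"
    if uv: "u \<in> verts G" "v \<in> verts G" for u v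
  proof -
    define d where "d = (LEAST m. (u, v) \<in> arcs_ends G ^^ m)"
    obtain m where m: "m + k \<le> n + 1" "(u, v) \<in> arcs_ends G ^^ m"
      using k_tree_short_walk[OF assms(2,1) uv] assms(3) by blast
    have d: "(u, v) \<in> arcs_ends G ^^ d" "\<And>l. (u, v) \<in> arcs_ends G ^^ l \<Longrightarrow> d \<le> l"
      unfolding d_def using m(2) by (auto intro: LeastI Least_le)
    have "d + 1 \<le> 2 * card (c' ` verts G)"
      using k_tree_graph[OF assms(2)] c'(1) uv(1) d by (rule dominated_coloring_shortest_walk)
    then have "d \<le> 2 * k + 1" using c'(2) by simp
    moreover have "d + 2 * k \<le> 2 * n + 1"
      using d(2)[OF m(2)] m(1) order by simp
    ultimately have "real d \<le> min (2 * real k + 1) (2 * (real n - real k) + 1)"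
      unfolding min_def by auto
    then show ?thesis
      using graph_dist_le_of_relpow[OF wf_digraph d(1) uv(2)] by (meson ereal_less_eq(3) order_trans)
  qed
  then show ?thesis
    unfolding diam_def by (intro SUP_least) auto
qed

end
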